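(* Let $\mathbb{K}$ be an algebraically closed field of characteristic zero, $\mathbbm{i}\in\mathbb{K}$ a primitive fourth root of unity, and $\pi:\mathbb{G}\to\mathbb{P}^5$ the Plücker embedding of the Grassmannian $\mathbb{G}$ of lines in $\mathbb{P}^3$. Let $C_1,\dots,C_{10}$ be the irreducible components of the line scheme of $S$ (respectively $T$), as listed in the context. For each $i$, the quadric $Q_i\subset\mathbb{P}^3$ associated to $C_i$, and linear forms $f_i,g_i$ (depending on $[s:t]\in\mathbb{P}^1$) such that $\pi^{-1}(C_i)=\{\mathcal{V}(f_i,g_i):[s:t]\in\mathbb{P}^1\}$ (this family of lines being a ruling of $Q_i$), are as follows. For $S$ (format: $Q_i$; $f_i$, $g_i$): - $C_1$: $\mathcal{V}(x_1x_3-x_2x_4)$; $sx_1+tx_2$, $tx_3+sx_4$. - $C_2$: $\mathcal{V}(x_1x_3+x_2x_4)$; $sx_1+tx_2$, $tx_3-sx_4$. - $C_3$: $\mathcal{V}(x_1x_4+x_2x_3)$; $sx_1+tx_3$, $sx_2-tx_4$. - $C_4$: $\mathcal{V}(x_1x_4-x_2x_3)$; $sx_1+tx_3$, $sx_2+tx_4$. - $C_5$: $\mathcal{V}(x_1x_2+x_3x_4)$; $sx_1+tx_4$, $tx_2-sx_3$. - $C_6$: $\mathcal{V}(x_1x_2-x_3x_4)$; $sx_1+tx_4$, $tx_2+sx_3$. - $C_7$: $\mathcal{V}((x_1^2-x_2^2)+(x_3^2-x_4^2))$; $s(x_1-x_2)+t(x_3+x_4)$, $t(x_1+x_2)-s(x_3-x_4)$.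 - $C_8$: $\mathcal{V}((x_1^2-x_2^2)-(x_3^2-x_4^2))$; $s(x_1-x_2)+t(x_3-x_4)$, $t(x_1+x_2)+s(x_3+x_4)$. - $C_9$: $\mathcal{V}((x_1^2+x_2^2)+(x_3^2+x_4^2))$; $s(x_1+\mathbbm{i}x_2)+t(x_3+\mathbbm{i}x_4)$, $t(x_1-\mathbbm{i}x_2)-s(x_3-\mathbbm{i}x_4)$. - $C_{10}$: $\mathcal{V}((x_1^2+x_2^2)-(x_3^2+x_4^2))$; $s(x_1+\mathbbm{i}x_2)+t(x_3-\mathbbm{i}x_4)$, $t(x_1-\mathbbm{i}x_2)+s(x_3+\mathbbm{i}x_4)$. For $T$: - $C_1$: $\mathcal{V}(x_1x_3-\mathbbm{i}x_2x_4)$; $sx_1+tx_2$, $tx_3+\mathbbm{i}sx_4$. - $C_2$: $\mathcal{V}(x_1x_3+\mathbbm{i}x_2x_4)$; $sx_1+tx_2$, $tx_3-\mathbbm{i}sx_4$. - $C_3$: $\mathcal{V}(x_1x_4+\mathbbm{i}x_2x_3)$; $sx_1+tx_3$, $sx_2+\mathbbm{i}tx_4$. - $C_4$: $\mathcal{V}(x_1x_4-\mathbbm{i}x_2x_3)$; $sx_1+tx_3$, $sx_2-\mathbbm{i}tx_4$. - $C_5$: $\mathcal{V}(x_1x_2+x_3x_4)$; $sx_1+tx_4$, $tx_2-sx_3$. - $C_6$: $\mathcal{V}(x_1x_2-x_3x_4)$; $sx_1+tx_4$, $tx_2+sx_3$. - $C_7$: $\mathcal{V}((x_1^2+x_2^2)+\mathbbm{i}(x_3^2-x_4^2))$;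 $s(x_1+\mathbbm{i}x_2)+t(x_3-x_4)$, $t(x_1-\mathbbm{i}x_2)-\mathbbm{i}s(x_3+x_4)$. - $C_8$: $\mathcal{V}((x_1^2+x_2^2)-\mathbbm{i}(x_3^2-x_4^2))$; $s(x_1+\mathbbm{i}x_2)+t(x_3+x_4)$, $t(x_1-\mathbbm{i}x_2)+\mathbbm{i}s(x_3-x_4)$. - $C_9$: $\mathcal{V}((x_1^2-x_2^2)+\mathbbm{i}(x_3^2+x_4^2))$; $s(x_1+x_2)+t(x_3-\mathbbm{i}x_4)$, $t(x_1-x_2)-\mathbbm{i}s(x_3+\mathbbm{i}x_4)$. - $C_{10}$: $\mathcal{V}((x_1^2-x_2^2)-\mathbbm{i}(x_3^2+x_4^2))$; $s(x_1+x_2)+t(x_3+\mathbbm{i}x_4)$, $t(x_1-x_2)+\mathbbm{i}s(x_3-\mathbbm{i}x_4)$.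
   Context: $S$ and $T$ are the $\mathbb{K}$-algebras on $x_1,\dots,x_4$ with relations $x_1x_2-x_3^2$, $x_4^2\mp x_2x_1$, $x_1x_3-x_2x_4$, $x_4x_1-x_3x_2$, $x_2x_3-x_3x_1$, $x_4x_2\mp x_1x_4$ (upper signs for $S$, lower for $T$). For the line $\ell$ through $[a_1:a_2:a_3:a_4]\ne[b_1:b_2:b_3:b_4]$, $M_{ij}(\ell)=a_ib_j-a_jb_i$ and $\pi(\ell)=[M_{12}:M_{13}:M_{14}:M_{23}:M_{24}:M_{34}](\ell)$; $\pi$ is an isomorphism onto $\mathcal{V}(P)$, $P=M_{12}M_{34}-M_{13}M_{24}+M_{14}M_{23}$. With $\alpha=1$ for $S$ and $\alpha=\mathbbm{i}$ for $T$, the components of the line scheme are: $C_1,C_2=\mathcal{V}(M_{12},M_{34},M_{13}\mp\alpha M_{24},P)$; $C_3,C_4=\mathcal{V}(M_{13},M_{24},M_{14}\mp\alpha M_{23},P)$; $C_5,C_6=\mathcal{V}(M_{14},M_{23},M_{12}\mp M_{34},P)$ (upper sign for the first-named component); $C_7=\mathcal{V}(M_{12}-M_{34},M_{13}-\alpha M_{24},M_{14}-\alpha M_{23},P)$; $C_8=\mathcal{V}(M_{12}-M_{34},M_{13}+\alpha M_{24},M_{14}+\alpha M_{23},P)$; $C_9=\mathcal{V}(M_{12}+M_{34},M_{13}-\alpha M_{24},M_{14}+\alpha M_{23},P)$; $C_{10}=\mathcal{V}(M_{12}+M_{34},M_{13}+\alpha M_{24},M_{14}-\alpha M_{23},P)$.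 Each $C_i$ is cut out of $\mathcal{V}(P)$ by three linear forms in the $M_{jk}$. Substituting $M_{jk}=x_jy_k-x_ky_j$ gives a system of three linear equations in $y_1,\dots,y_4$ with $3\times4$ coefficient matrix having entries linear in $x_1,\dots,x_4$; the quadric associated to $C_i$ is the set of points $[x_1:x_2:x_3:x_4]\in\mathbb{P}^3$ at which this matrix has rank $2$ (it always has rank at least $2$). A ruling of a smooth quadric surface is one of its two one-parameter families of lines. *)

theory Defs
  imports "HOL-Analysis.Analysis" "HOL-Computational_Algebra.Polynomial"
begin

definition primitive_root_of_unity :: "nat \<Rightarrow> 'a::field \<Rightarrow> bool" where
  "primitive_root_of_unity n z \<longleftrightarrow> n > 0 \<and> z ^ n = 1 \<and> (\<forall>k. 0 < k \<and> k < n \<longrightarrow> z ^ k \<noteq> 1)"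

section \<open>Projective space\<close>

text \<open>A point of the projective space of a coordinate space is a one-dimensional subspace;
  \<open>proj_pt x\<close> is the point with homogeneous coordinates \<open>x\<close>, for nonzero \<open>x\<close>.
  Subsets of projective space are sets of such points.\<close>

definition proj_pt :: "'a::field^'n \<Rightarrow> ('a^'n) set" where
  "proj_pt x = vec.span {x}"

text \<open>Only applied to sets of homogeneous polynomial functions, so that vanishing at a
  point does not depend on the chosen coordinate vector.\<close>

definition proj_zeros :: "('a::field^'n \<Rightarrow> 'a) set \<Rightarrow> ('a^'n) set set" where
  "proj_zeros F = {proj_pt x | x. x \<noteq> 0 \<and> (\<forall>f\<in>F. f x = 0)}"

section \<open>Lines in three-space and the Pluecker embedding\<close>

definition line_through :: "'a::field^'n \<Rightarrow> 'a^'n \<Rightarrow> ('a^'n) set set" where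
  "line_through a b = {proj_pt x | x. x \<noteq> 0 \<and> x \<in> vec.span {a, b}}"

definition distinct_pts :: "'a::field^'n \<Rightarrow> 'a^'n \<Rightarrow> bool" where
  "distinct_pts a b \<longleftrightarrow> a \<noteq> 0 \<and> b \<noteq> 0 \<and> proj_pt a \<noteq> proj_pt b"

definition grassmannian :: "('a::field^4) set set set" where
  "grassmannian = {line_through a b | a b. distinct_pts a b}"

text \<open>Homogeneous coordinates on projective five-space are ordered as
  12, 13, 14, 23, 24, 34.\<close>

abbreviation M12 :: "'a^6 \<Rightarrow> 'a" where "M12 m \<equiv> m $ 1"
abbreviation M13 :: "'a^6 \<Rightarrow> 'a" where "M13 m \<equiv> m $ 2"
abbreviation M14 :: "'a^6 \<Rightarrow> 'a" where "M14 m \<equiv> m $ 3"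
abbreviation M23 :: "'a^6 \<Rightarrow> 'a" where "M23 m \<equiv> m $ 4"
abbreviation M24 :: "'a^6 \<Rightarrow> 'a" where "M24 m \<equiv> m $ 5"
abbreviation M34 :: "'a^6 \<Rightarrow> 'a" where "M34 m \<equiv> m $ 6"

definition minors :: "'a::field^4 \<Rightarrow> 'a^4 \<Rightarrow> 'a^6" where
  "minors a b = vector
     [a$1 * b$2 - a$2 * b$1, a$1 * b$3 - a$3 * b$1, a$1 * b$4 - a$4 * b$1,
      a$2 * b$3 - a$3 * b$2, a$2 * b$4 - a$4 * b$2, a$3 * b$4 - a$4 * b$3]"

definition plucker_poly :: "'a::field^6 \<Rightarrow> 'a" where
  "plucker_poly m = M12 m * M34 m - M13 m * M24 m + M14 m * M23 m"

text \<open>The choice of \<open>a\<close> and \<open>b\<close> on the line is immaterial, see \<open>plucker_line_through\<close> below.\<close>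

definition plucker :: "('a::field^4) set set \<Rightarrow> ('a^6) set" where
  "plucker l = (THE p. \<exists>a b. distinct_pts a b \<and> l = line_through a b \<and> p = proj_pt (minors a b))"

lemma vector_6:
  "(vector [a, b, c, d, e, f] :: 'a::zero^6) $ 1 = a"
  "(vector [a, b, c, d, e, f] :: 'a::zero^6) $ 2 = b"
  "(vector [a, b, c, d, e, f] :: 'a::zero^6) $ 3 = c"
  "(vector [a, b, c, d, e, f] :: 'a::zero^6) $ 4 = d"
  "(vector [a, b, c, d, e, f] :: 'a::zero^6) $ 5 = e"
  "(vector [a, b, c, d, e, f] :: 'a::zero^6) $ 6 = f"
  by (simp_all add: vector_def)

lemma exhaust_6: "i = 1 \<or> i = 2 \<or> i = 3 \<or> i = 4 \<or> i = 5 \<or> i = 6" for i :: 6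
proof (induct i)
  case (of_int z)
  then have "z = 0 \<or> z = 1 \<or> z = 2 \<or> z = 3 \<or> z = 4 \<or> z = 5" by auto
  then show ?case by auto
qed

lemma forall_6: "(\<forall>i::6. Q i) \<longleftrightarrow> Q 1 \<and> Q 2 \<and> Q 3 \<and> Q 4 \<and> Q 5 \<and> Q 6"
  by (metis exhaust_6)

lemma in_span_pair:
  "x \<in> vec.span {a, b} \<longleftrightarrow> (\<exists>s t. x = s *s a + t *s b)" for a :: "'a::field^'n"
proof -
  have "x \<in> vec.span {a, b} \<longleftrightarrow> (\<exists>s t. x - s *s a = t *s b)"
    by (auto simp: vec.span_breakdown_eq[of x a] vec.span_singleton)
  then show ?thesis by (simp add: diff_eq_eq add.commute)
qed

lemma minors_comb:
  "minors (p *s a + q *s b) (r *s a + s *s b) = (p * s - q * r) *s minors a b"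
  by (simp add: vec_eq_iff forall_6 minors_def vector_6 algebra_simps)

lemma minors_eq_0: 
  assumes "minors a b = 0" "a \<noteq> 0"
  shows "\<exists>c. b = c *s a"
proof -
  have e: "a$i * b$j = a$j * b$i" for i j
  proof -
    have "\<forall>i j. a$i * b$j = a$j * b$i"
      using assms(1) by (simp add: vec_eq_iff forall_6 forall_4 minors_def vector_6)
    then show ?thesis by blast
  qed
  obtain k where k: "a$k \<noteq> 0" using assms(2) by (auto simp: vec_eq_iff)
  have "b = (b$k / a$k) *s a"
    using k e[of k] by (simp add: vec_eq_iff field_simps)
  then show ?thesis ..
qed

lemma proj_pt_scale:
  assumes "c \<noteq> 0" shows "proj_pt (c *s x) = proj_pt x"
proof -
  have "k *s x = (k / c) *s (c *s x)" for k using assms by simp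
  then show ?thesis
    unfolding proj_pt_def vec.span_singleton by (auto simp only: vec.scale_scale)
qed

lemma mem_proj_pt: "x \<in> proj_pt x"
  by (simp add: proj_pt_def vec.span_base)

lemma minors_nonzero:
  assumes "distinct_pts a b" shows "minors a b \<noteq> 0"
proof
  assume "minors a b = 0"
  then obtain c where c: "b = c *s a"
    using minors_eq_0 assms unfolding distinct_pts_def by blast
  then have "c \<noteq> 0" using assms by (auto simp: distinct_pts_def)
  then show False using c assms by (simp add: distinct_pts_def proj_pt_scale)
qed

lemma line_through_subset:
  assumes "line_through c d = line_through a b" "c \<noteq> 0"
  shows "c \<in> vec.span {a, b}"
proof -
  have "proj_pt c \<in> line_through c d"
    using assms(2) by (auto simp: line_through_def intro!: exI[of _ c] vec.span_base)
  then have "proj_pt c \<in> line_through a b" by (simp only: assms(1))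
  then obtain x where x: "x \<in> vec.span {a, b}" "proj_pt c = proj_pt x"
    unfolding line_through_def by blast
  have "c \<in> vec.span {x}" using mem_proj_pt[of c] x(2) by (simp add: proj_pt_def)
  also have "\<dots> \<subseteq> vec.span {a, b}"
    using x(1) by (simp add: vec.span_minimal)
  finally show ?thesis .
qed

lemma plucker_line_through:
  assumes "distinct_pts a b"
  shows "plucker (line_through a b) = proj_pt (minors a b)"
  unfolding plucker_def
proof (rule the_equality)
  show "\<exists>c d. distinct_pts c d \<and> line_through a b = line_through c d
    \<and> proj_pt (minors a b) = proj_pt (minors c d)"
    using assms by blast
next
  fix p assume "\<exists>c d. distinct_pts c d \<and> line_through a b = line_through c d
    \<and> p = proj_pt (minors c d)"
  then obtain c d where cd: "distinct_pts c d" "line_through c d = line_through a b"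
    "p = proj_pt (minors c d)" by auto
  have dc: "line_through d c = line_through a b"
    using cd(2) by (simp add: line_through_def insert_commute)
  have "c \<in> vec.span {a, b}" "d \<in> vec.span {a, b}"
    using line_through_subset[OF cd(2)] line_through_subset[OF dc] cd(1)
    by (auto simp: distinct_pts_def)
  then obtain s t u v where "c = s *s a + t *s b" "d = u *s a + v *s b"
    unfolding in_span_pair by blast
  then have m: "minors c d = (s * v - t * u) *s minors a b" by (simp add: minors_comb)
  then have "s * v - t * u \<noteq> 0" using minors_nonzero[OF cd(1)] by auto
  then show "p = proj_pt (minors a b)" unfolding cd(3) m by (rule proj_pt_scale)
qed

section \<open>Components of the line scheme\<close>

datatype component = C1 | C2 | C3 | C4 | C5 | C6 | C7 | C8 | C9 | C10

text \<open>The algebras \<open>S\<close> and \<open>T\<close> have generators \<open>x1, x2, x3, x4\<close> and relations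
  \<open>x1 x2 - x3^2\<close>, \<open>x4^2 \<mp> x2 x1\<close>, \<open>x1 x3 - x2 x4\<close>, \<open>x4 x1 - x3 x2\<close>, \<open>x2 x3 - x3 x1\<close>,
  \<open>x4 x2 \<mp> x1 x4\<close>, with the upper signs for \<open>S\<close> and the lower signs for \<open>T\<close>. Their line
  schemes enter only through the equations of the irreducible components: below are the three
  linear forms which, together with the Pluecker polynomial, cut out each component, with
  \<open>\<alpha> = 1\<close> for \<open>S\<close> and \<open>\<alpha>\<close> the given primitive fourth root of unity for \<open>T\<close>.\<close>

primrec linear_forms :: "'a::field \<Rightarrow> component \<Rightarrow> 'a^6 \<Rightarrow> 'a^3" where
  "linear_forms \<alpha> C1 = (\<lambda>m. vector [M12 m, M34 m, M13 m - \<alpha> * M24 m])"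
| "linear_forms \<alpha> C2 = (\<lambda>m. vector [M12 m, M34 m, M13 m + \<alpha> * M24 m])"
| "linear_forms \<alpha> C3 = (\<lambda>m. vector [M13 m, M24 m, M14 m - \<alpha> * M23 m])"
| "linear_forms \<alpha> C4 = (\<lambda>m. vector [M13 m, M24 m, M14 m + \<alpha> * M23 m])"
| "linear_forms \<alpha> C5 = (\<lambda>m. vector [M14 m, M23 m, M12 m - M34 m])"
| "linear_forms \<alpha> C6 = (\<lambda>m. vector [M14 m, M23 m, M12 m + M34 m])"
| "linear_forms \<alpha> C7 = (\<lambda>m. vector [M12 m - M34 m, M13 m - \<alpha> * M24 m, M14 m - \<alpha> * M23 m])"
| "linear_forms \<alpha> C8 = (\<lambda>m. vector [M12 m - M34 m, M13 m + \<alpha> * M24 m, M14 m + \<alpha> * M23 m])"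
| "linear_forms \<alpha> C9 = (\<lambda>m. vector [M12 m + M34 m, M13 m - \<alpha> * M24 m, M14 m + \<alpha> * M23 m])"
| "linear_forms \<alpha> C10 = (\<lambda>m. vector [M12 m + M34 m, M13 m + \<alpha> * M24 m, M14 m - \<alpha> * M23 m])"

definition component_set :: "'a::field \<Rightarrow> component \<Rightarrow> ('a^6) set set" where
  "component_set \<alpha> c =
     proj_zeros (insert plucker_poly (range (\<lambda>k m. linear_forms \<alpha> c m $ k)))"

definition component_lines :: "'a::field \<Rightarrow> component \<Rightarrow> ('a^4) set set set" where
  "component_lines \<alpha> c = {l \<in> grassmannian. plucker l \<in> component_set \<alpha> c}"

text \<open>For fixed \<open>x\<close> the map below is linear in \<open>y\<close>, so \<open>matrix\<close> yields the coefficient matrix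
  of the system of three linear equations in \<open>y\<close>.\<close>

definition coeff_matrix :: "'a::field \<Rightarrow> component \<Rightarrow> 'a^4 \<Rightarrow> 'a^4^3" where
  "coeff_matrix \<alpha> c x = matrix (\<lambda>y. linear_forms \<alpha> c (minors x y))"

definition associated_quadric :: "'a::field \<Rightarrow> component \<Rightarrow> ('a^4) set set" where
  "associated_quadric \<alpha> c = {proj_pt x | x. x \<noteq> 0 \<and> rank (coeff_matrix \<alpha> c x) = 2}"

section \<open>Rulings\<close>

definition quadratic_form :: "'a::field^4^4 \<Rightarrow> 'a^4 \<Rightarrow> 'a" where
  "quadratic_form A x = (\<Sum>i\<in>UNIV. \<Sum>j\<in>UNIV. A $ i $ j * x $ i * x $ j)"

text \<open>For symmetric \<open>A\<close> the gradient of the quadratic form at \<open>x\<close> is twice \<open>A *v x\<close>.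
  In characteristic other than two, the last condition therefore says that the partial
  derivatives have no common zero on the surface.\<close>

definition smooth_quadric :: "('a::field^4) set set \<Rightarrow> bool" where
  "smooth_quadric Q \<longleftrightarrow> (\<exists>A. transpose A = A \<and> Q = proj_zeros {quadratic_form A} \<and>
     (\<forall>x. x \<noteq> 0 \<and> quadratic_form A x = 0 \<longrightarrow> A *v x \<noteq> 0))"

definition lines_on :: "('a::field^4) set set \<Rightarrow> ('a^4) set set set" where
  "lines_on Q = {l \<in> grassmannian. l \<subseteq> Q}"

text \<open>The lines on a smooth quadric surface form two families, each of which has exactly one
  member through every point of the surface. This determines the unordered pair of families:
  lines from different families meet, so a pairwise disjoint set of lines lies in one family.\<close>

definition is_ruling :: "('a::field^4) set set set \<Rightarrow> ('a^4) set set \<Rightarrow> bool" where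
  "is_ruling R Q \<longleftrightarrow> smooth_quadric Q \<and>
     (\<exists>R'. R \<union> R' = lines_on Q \<and> R \<inter> R' = {} \<and> partition_on Q R \<and> partition_on Q R')"

definition quadric_and_ruling ::
    "'a::field \<Rightarrow> component \<Rightarrow> ('a^4 \<Rightarrow> 'a) \<Rightarrow>
     ('a \<Rightarrow> 'a \<Rightarrow> 'a^4 \<Rightarrow> 'a) \<Rightarrow> ('a \<Rightarrow> 'a \<Rightarrow> 'a^4 \<Rightarrow> 'a) \<Rightarrow> bool" where
  "quadric_and_ruling \<alpha> c q f g \<longleftrightarrow>
     associated_quadric \<alpha> c = proj_zeros {q} \<and>
     component_lines \<alpha> c = {proj_zeros {f s t, g s t} | s t. (s, t) \<noteq> (0, 0)} \<and>
     is_ruling (component_lines \<alpha> c) (associated_quadric \<alpha> c)"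

end

theory Submission
  imports Defs
begin

text \<open>In every case there are linear coordinates \<open>A, B, C, D\<close> on the four-space, the entries of a
  \<open>2 \<times> 2\<close> matrix, such that the quadric is \<open>A D - B C = 0\<close> and the pair \<open>f, g\<close> is
  \<open>s A + t B, s C + t D\<close>: the lines are the loci of matrices killed by a fixed column vector, and
  the opposite ruling consists of those killed by a fixed row vector. If \<open>N\<close> denotes the Pluecker
  coordinates of a line in terms of \<open>A, B, C, D\<close>, then membership in the ruling is
  \<open>N12 = N34 = 0\<close>, \<open>N14 = N23\<close>, and the three linear forms of the component span the same space
  as these. The kernel of the coefficient matrix at \<open>x\<close> is spanned by the lines of the ruling
  through \<open>x\<close>, hence has dimension two on the quadric and one elsewhere.\<close>

lemma vector_4:
  "(vector [a, b, c, d] :: 'a::zero^4) $ 1 = a"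
  "(vector [a, b, c, d] :: 'a::zero^4) $ 2 = b"
  "(vector [a, b, c, d] :: 'a::zero^4) $ 3 = c"
  "(vector [a, b, c, d] :: 'a::zero^4) $ 4 = d"
  by (simp_all add: vector_def)

section \<open>Rank and nullity over a field\<close>

text \<open>Writing each column in a basis \<open>B\<close> of the column space factors
  \<open>A\<close> through \<open>card B\<close> coordinates, and the coefficient vectors
  \<open>r b\<close> then span the rows. Applied to \<open>A\<close> and \<open>transpose A\<close>,
  this makes row and column rank agree.\<close>

lemma dim_rows_le_dim_columns_field:
  fixes A :: "'a::field^'n^'m"
  shows "vec.dim (rows A) \<le> vec.dim (columns A)"
proof -
  obtain B where B: "B \<subseteq> columns A" "vec.independent B" "columns A \<subseteq> vec.span B"
      "card B = vec.dim (columns A)"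
    using vec.basis_exists by blast
  have fin: "finite B"
    using B(2) vec.finiteI_independent by blast
  have "\<exists>u. column j A = (\<Sum>b\<in>B. u b *s b)" for j
    using B(3) vec.span_finite[OF fin] by (auto simp: columns_def)
  then obtain u where u: "column j A = (\<Sum>b\<in>B. u j b *s b)" for j
    by metis
  define r where "r b = (\<chi> j. u j b)" for b
  have "row i A = (\<Sum>b\<in>B. b $ i *s r b)" for i
  proof -
    have "A $ i $ j = (\<Sum>b\<in>B. u j b * b $ i)" for j
      using arg_cong[OF u[of j], of "\<lambda>v. v $ i"] by (simp add: column_def sum_component)
    then show ?thesis
      by (simp add: vec_eq_iff row_def r_def sum_component mult.commute)
  qed
  then have "rows A \<subseteq> vec.span (r ` B)"
    by (auto simp: rows_def intro!: vec.span_sum vec.span_scale intro: vec.span_base)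
  then have "vec.dim (rows A) \<le> card (r ` B)"
    using fin by (intro vec.dim_le_card) auto
  also have "\<dots> \<le> card B"
    using fin by (rule card_image_le)
  finally show ?thesis
    using B(4) by simp
qed

text \<open>A basis \<open>B\<close> of the kernel extends to a basis \<open>E\<close> of the whole
  space. The map is injective on the span of \<open>E - B\<close> and attains its whole range there,
  so \<open>card (E - B)\<close> is the column rank.\<close>

lemma rank_nullity:
  fixes A :: "'a::field^'n^'m"
  shows "rank A + vec.dim {x. A *v x = 0} = CARD('n)"
proof -
  define K where "K = {x. A *v x = 0}"
  have K: "vec.subspace K"
    by (auto simp: K_def vec.subspace_def vec.add vec.scale)
  obtain B where B: "B \<subseteq> K" "vec.independent B" "K \<subseteq> vec.span B" "card B = vec.dim K"
    using vec.basis_exists by blast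
  obtain E where E: "B \<subseteq> E" "vec.independent E" "UNIV \<subseteq> vec.span E"
    using vec.maximal_independent_subset_extend[OF _ B(2), of UNIV] by auto
  have fin: "finite E"
    using E(2) vec.finiteI_independent by blast
  have cE: "card E = CARD('n)"
    using E(2,3) vec.dim_eq_card[of E UNIV] by (simp add: card_cart_basis top.extremum_uniqueI)
  have ind: "vec.independent (E - B)"
    using E(2) vec.independent_mono by blast
  \<comment> \<open>Dimension count: the two subspaces add up to the whole space and their
    dimensions to \<open>CARD('n)\<close>.\<close>
  have int: "K \<inter> vec.span (E - B) = {0}"
  proof -
    have "{x + y |x y. x \<in> K \<and> y \<in> vec.span (E - B)} = UNIV"
    proof -
      have "K = vec.span B"
        using B(1,3) K vec.span_subspace by blast
      then show ?thesis
        using E(1,3) vec.span_Un[of B "E - B"] by (auto simp: Un_absorb1)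
    qed
    then have "CARD('n) + vec.dim (K \<inter> vec.span (E - B)) = vec.dim K + card (E - B)"
      using vec.dim_sums_Int[OF K vec.subspace_span[of "E - B"]] ind
      by (simp add: card_cart_basis vec.dim_eq_card_independent)
    also have "\<dots> = CARD('n)"
      using B(4) cE E(1) fin card_mono[OF fin E(1)] by (simp add: card_Diff_subset card_mono finite_subset)
    finally show ?thesis
      using K by (auto simp: vec.subspace_0 vec.span_zero)
  qed
  have inj: "inj_on ((*v) A) (vec.span (E - B))"
  proof (rule inj_onI)
    fix x y assume "x \<in> vec.span (E - B)" "y \<in> vec.span (E - B)" "A *v x = A *v y"
    then have "x - y \<in> K \<inter> vec.span (E - B)"
      by (simp add: K_def vec.diff vec.span_diff)
    then show "x = y" using int by simp
  qed
  have rng: "range ((*v) A) = (*v) A ` vec.span (E - B)"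
  proof -
    have "A *v x \<in> (*v) A ` vec.span (E - B)" for x
    proof -
      have "x \<in> vec.span (B \<union> (E - B))"
        using E(1,3) by (auto simp: Un_absorb1)
      then obtain y z where "x = y + z" "y \<in> vec.span B" "z \<in> vec.span (E - B)"
        unfolding vec.span_Un by blast
      moreover have "A *v y = 0"
        using \<open>y \<in> vec.span B\<close> vec.span_minimal[OF B(1) K] by (auto simp: K_def)
      ultimately show ?thesis by (auto simp: vec.add)
    qed
    then show ?thesis by blast
  qed
  \<comment> \<open>Columns are images of unit vectors, so the column space is the range.\<close>
  have "column j A = A *v axis j 1" for j
    by (simp add: vec_eq_iff column_def matrix_vector_mult_def axis_def if_distrib cong: if_cong)
  then have "vec.dim (columns A) = vec.dim (range ((*v) A))"
    using matrix_vector_mult_in_columnspace_gen[of A]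
    by (intro antisym vec.dim_mono) (auto simp: columns_def intro: vec.span_base)
  also have "\<dots> = vec.dim (vec.span (E - B))"
    unfolding rng by (intro vec.dim_image_eq matrix_vector_mul_linear_gen) (subst vec.span_span, rule inj)
  also have "\<dots> = card (E - B)"
    using ind by (simp add: vec.dim_eq_card_independent)
  finally have "vec.dim (columns A) = card (E - B)" .
  moreover have "rank A = vec.dim (columns A)"
    using dim_rows_le_dim_columns_field[of A] dim_rows_le_dim_columns_field[of "transpose A"]
    by (simp add: row_rank_def_gen)
  ultimately show ?thesis
    using B(4) cE E(1) fin card_mono[OF fin E(1)] by (simp add: K_def card_Diff_subset card_mono finite_subset)
qed

section \<open>Points and lines\<close>

lemma proj_pt_eq_imp: "proj_pt x = proj_pt y \<Longrightarrow> \<exists>c. x = c *s y"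
  using mem_proj_pt[of x] by (auto simp: proj_pt_def vec.span_singleton)

lemma mem_proj_zeros:
  assumes "x \<noteq> 0" "\<And>f c y. f \<in> F \<Longrightarrow> f y = 0 \<Longrightarrow> f (c *s y) = 0"
  shows "proj_pt x \<in> proj_zeros F \<longleftrightarrow> (\<forall>f\<in>F. f x = 0)"
proof
  assume "proj_pt x \<in> proj_zeros F"
  then obtain y where y: "proj_pt x = proj_pt y" "\<forall>f\<in>F. f y = 0"
    by (auto simp: proj_zeros_def)
  then show "\<forall>f\<in>F. f x = 0"
    using proj_pt_eq_imp[OF y(1)] assms(2) by blast
qed (use assms(1) in \<open>auto simp: proj_zeros_def\<close>)

lemma distinct_pts_iff: "distinct_pts a b \<longleftrightarrow> a \<noteq> 0 \<and> (\<forall>c. b \<noteq> c *s a)"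
proof
  assume *: "distinct_pts a b"
  have False if "b = c *s a" for c
    using * that proj_pt_scale[of c a] by (cases "c = 0") (auto simp: distinct_pts_def)
  then show "a \<noteq> 0 \<and> (\<forall>c. b \<noteq> c *s a)"
    using * by (auto simp: distinct_pts_def)
next
  assume *: "a \<noteq> 0 \<and> (\<forall>c. b \<noteq> c *s a)"
  then have "b \<noteq> 0" by (metis vec.scale_zero_left)
  with * show "distinct_pts a b"
    using proj_pt_eq_imp[of b a] by (auto simp: distinct_pts_def)
qed

lemma dim_distinct_pts:
  assumes "distinct_pts a b" shows "vec.dim {a, b} = 2"
  using assms by (auto simp: distinct_pts_iff insert_commute[of a b] vec.dim_insert[of b] vec.span_singleton)

lemma span_distinct_pts:
  assumes "distinct_pts a b" "vec.subspace V" "vec.dim V = 2" "a \<in> V" "b \<in> V"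
  shows "vec.span {a, b} = V"
  using assms by (intro vec.subspace_dim_equal) (auto simp: vec.span_minimal dim_distinct_pts)

text \<open>Parametrises the rows of a matrix that kills the column \<open>(s, t)\<close>.\<close>

lemma kernel_pair:
  fixes s t :: "'a::field"
  assumes "s * a + t * b = 0" "(s, t) \<noteq> (0, 0)"
  obtains k where "a = k * t" "b = - k * s"
proof (cases "t = 0")
  case True
  with assms have "a = (- b / s) * t" "b = - (- b / s) * s" by auto
  then show ?thesis by (rule that)
next
  case False
  with assms have "a = (a / t) * t" "b = - (a / t) * s"
    by (auto simp: field_simps eq_neg_iff_add_eq_0 add.commute)
  then show ?thesis by (rule that)
qed

section \<open>The rulings of the quadric of singular matrices\<close>

text \<open>The rows of \<open>P\<close> are the linear forms \<open>A, B, C, D\<close>.\<close>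

definition det_plane :: "'a::field^4^4 \<Rightarrow> 'a \<Rightarrow> 'a \<Rightarrow> ('a^4) set" where
  "det_plane P s t = {x. s * (P *v x) $ 1 + t * (P *v x) $ 2 = 0 \<and>
                         s * (P *v x) $ 3 + t * (P *v x) $ 4 = 0}"

definition det_line :: "'a::field^4^4 \<Rightarrow> 'a \<Rightarrow> 'a \<Rightarrow> ('a^4) set set" where
  "det_line P s t = {proj_pt x | x. x \<noteq> 0 \<and> x \<in> det_plane P s t}"

definition det_ruling :: "'a::field^4^4 \<Rightarrow> ('a^4) set set set" where
  "det_ruling P = {det_line P s t | s t. (s, t) \<noteq> (0, 0)}"

definition det_form :: "'a::field^4^4 \<Rightarrow> 'a^4 \<Rightarrow> 'a" where
  "det_form P x = (P *v x) $ 1 * (P *v x) $ 4 - (P *v x) $ 2 * (P *v x) $ 3"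

text \<open>Transposition of the matrix with entries \<open>A, B, C, D\<close>: kernel columns
  become kernel rows, so this gives the opposite ruling.\<close>

definition swap_mid :: "'a::field^4^4 \<Rightarrow> 'a^4^4" where
  "swap_mid P = vector [P $ 1, P $ 3, P $ 2, P $ 4]"

lemma swap_mid_mult:
  "(swap_mid P *v x) $ 1 = (P *v x) $ 1" "(swap_mid P *v x) $ 2 = (P *v x) $ 3"
  "(swap_mid P *v x) $ 3 = (P *v x) $ 2" "(swap_mid P *v x) $ 4 = (P *v x) $ 4"
  by (simp_all add: swap_mid_def matrix_vector_mult_def vector_4)

lemma det_form_swap_mid: "det_form (swap_mid P) = det_form P"
  by (simp add: fun_eq_iff det_form_def swap_mid_mult mult.commute)

lemma proj_pt_mem_line_through:
  assumes "distinct_pts a b"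
  shows "proj_pt a \<in> line_through a b" "proj_pt b \<in> line_through a b"
  using assms by (auto simp: line_through_def distinct_pts_def intro!: exI vec.span_base)

text \<open>If \<open>a\<close> is nonzero, the second row is \<open>c / a\<close> times the first;
  otherwise the first row or the first column vanishes.\<close>

lemma rank_one_factor:
  fixes a b c d :: "'a::field"
  assumes "a * d = b * c"
  obtains p q p' q' where "a = p * q" "b = p * q'" "c = p' * q" "d = p' * q'"
proof (cases "a = 0")
  case False
  then show ?thesis
    using assms that[of 1 a b "c / a"] by (simp add: field_simps)
next
  case True
  then consider "b = 0" | "c = 0" using assms by auto
  then show ?thesis
  proof cases
    case 1 then show ?thesis using True that[of 0 c d 1] by simp
  next
    case 2 then show ?thesis using True that[of b 0 1 d] by simp
  qed
qed

text \<open>Stated for pairs of vectors rather than lines: for fixed \<open>x\<close> it is a linear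
  condition on \<open>y\<close>, to be matched with the kernel of the coefficient matrix.\<close>

definition det_aligned :: "'a::field^4^4 \<Rightarrow> 'a^4 \<Rightarrow> 'a^4 \<Rightarrow> bool" where
  "det_aligned P x y \<longleftrightarrow>
     M12 (minors (P *v x) (P *v y)) = 0 \<and> M34 (minors (P *v x) (P *v y)) = 0 \<and>
     M14 (minors (P *v x) (P *v y)) = M23 (minors (P *v x) (P *v y))"

lemmas minors_simps = minors_def vector_6

locale det_quadric =
  fixes P :: "'a::field_char_0^4^4"
  assumes ker: "P *v x = 0 \<Longrightarrow> x = 0"
begin

lemma surj: obtains x where "P *v x = y"
proof -
  obtain Q where "P ** Q = mat 1"
    using ker matrix_left_right_inverse matrix_left_invertible_ker by metis
  then have "P *v (Q *v y) = y" by (simp add: matrix_vector_mul_assoc)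
  then show ?thesis by (rule that)
qed

lemma eq_iff: "P *v x = P *v y \<longleftrightarrow> x = y"
  using ker[of "x - y"] by (auto simp: vec.diff)

lemma distinct_pts_image: "distinct_pts (P *v x) (P *v y) \<longleftrightarrow> distinct_pts x y"
  using eq_iff[of x 0] by (simp add: distinct_pts_iff eq_iff flip: vec.scale)

lemma det_form_scale: "det_form P (c *s x) = c\<^sup>2 * det_form P x"
  by (simp add: det_form_def vec.scale power2_eq_square algebra_simps)

section \<open>Planes and lines of the ruling, and their Pluecker coordinates\<close>

lemma subspace_det_plane: "vec.subspace (det_plane P s t)"
proof -
  have add: "s * (a + a') + t * (b + b') = (s * a + t * b) + (s * a' + t * b')"
    and scale: "s * (c * a) + t * (c * b) = c * (s * a + t * b)" for a a' b b' c :: 'a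
    by (simp_all add: algebra_simps)
  show ?thesis
    by (simp add: vec.subspace_def det_plane_def vec.add vec.scale add scale)
qed

text \<open>Each row of a matrix in the plane is a multiple of \<open>(t, - s)\<close>,
  independently of the other; \<open>u\<close> and \<open>v\<close> carry this row in one place and
  zero in the other.\<close>

lemma det_plane_basis:
  assumes "(s, t) \<noteq> (0, 0)"
  obtains u v where "distinct_pts u v" "det_plane P s t = vec.span {u, v}"
proof -
  obtain u where u: "P *v u = vector [t, - s, 0, 0]" using surj by blast
  obtain v where v: "P *v v = vector [0, 0, t, - s]" using surj by blast
  have "distinct_pts (P *v u) (P *v v)"
    using assms by (auto simp: u v distinct_pts_iff vec_eq_iff forall_4 vector_4)
  then have "distinct_pts u v" by (simp add: distinct_pts_image)
  moreover have "det_plane P s t = vec.span {u, v}"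
  proof (intro equalityI subsetI)
    fix x assume x: "x \<in> det_plane P s t"
    obtain k where k: "(P *v x) $ 1 = k * t" "(P *v x) $ 2 = - k * s"
      using x assms kernel_pair unfolding det_plane_def by blast
    obtain l where l: "(P *v x) $ 3 = l * t" "(P *v x) $ 4 = - l * s"
      using x assms kernel_pair unfolding det_plane_def by blast
    have "P *v x = P *v (k *s u + l *s v)"
      using k l by (simp add: vec.add vec.scale u v vec_eq_iff forall_4 vector_4)
    then show "x \<in> vec.span {u, v}"
      by (auto simp: eq_iff in_span_pair)
  next
    fix x assume "x \<in> vec.span {u, v}"
    then show "x \<in> det_plane P s t"
      by (auto simp: in_span_pair det_plane_def vec.add vec.scale u v vector_4 algebra_simps)
  qed
  ultimately show ?thesis by (rule that)
qed

lemma dim_det_plane: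
  assumes "(s, t) \<noteq> (0, 0)"
  shows "vec.dim (det_plane P s t) = 2"
  using det_plane_basis[OF assms] by (metis dim_distinct_pts vec.dim_span)

lemma det_line_eq:
  assumes "(s, t) \<noteq> (0, 0)" "distinct_pts x y" "x \<in> det_plane P s t" "y \<in> det_plane P s t"
  shows "det_line P s t = line_through x y"
  using span_distinct_pts[OF assms(2) subspace_det_plane dim_det_plane] assms
  by (simp add: det_line_def line_through_def)

lemma mem_det_line:
  assumes "x \<noteq> 0"
  shows "proj_pt x \<in> det_line P s t \<longleftrightarrow> x \<in> det_plane P s t"
proof
  assume "proj_pt x \<in> det_line P s t"
  then obtain y where y: "proj_pt x = proj_pt y" "y \<in> det_plane P s t"
    by (auto simp: det_line_def)
  then show "x \<in> det_plane P s t"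
    using proj_pt_eq_imp[OF y(1)] vec.subspace_scale[OF subspace_det_plane] by auto
qed (use assms in \<open>auto simp: det_line_def\<close>)

text \<open>Both matrices have rows proportional to \<open>(t, - s)\<close>: minors within a row
  vanish, and the coordinates 14 and 23 both equal \<open>s * t * (l * k' - k * l')\<close>.\<close>

lemma det_aligned_if:
  assumes "(s, t) \<noteq> (0, 0)" "x \<in> det_plane P s t" "y \<in> det_plane P s t"
  shows "det_aligned P x y"
proof -
  obtain k where k: "(P *v x) $ 1 = k * t" "(P *v x) $ 2 = - k * s"
    using assms kernel_pair unfolding det_plane_def by blast
  obtain l where l: "(P *v x) $ 3 = l * t" "(P *v x) $ 4 = - l * s"
    using assms kernel_pair unfolding det_plane_def by blast
  obtain k' where k': "(P *v y) $ 1 = k' * t" "(P *v y) $ 2 = - k' * s"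
    using assms kernel_pair unfolding det_plane_def by blast
  obtain l' where l': "(P *v y) $ 3 = l' * t" "(P *v y) $ 4 = - l' * s"
    using assms kernel_pair unfolding det_plane_def by blast
  show ?thesis
    by (simp add: det_aligned_def minors_simps k l k' l')
qed

lemma det_plane_if_aligned:
  assumes "distinct_pts x y" "det_aligned P x y"
  obtains s t where "(s, t) \<noteq> (0, 0)" "x \<in> det_plane P s t" "y \<in> det_plane P s t"
proof -
  define m where "m = minors (P *v x) (P *v y)"
  have m: "M12 m = 0" "M34 m = 0" "M14 m = M23 m"
    using assms(2) by (auto simp: det_aligned_def m_def)
  have "m \<noteq> 0"
    using assms(1) by (simp add: m_def minors_nonzero distinct_pts_image)
  \<comment> \<open>For a line with kernel column \<open>(s, t)\<close> the coordinates 13, 14, 24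
    are \<open>t^2\<close>, \<open>- s * t\<close>, \<open>s^2\<close> up to a common factor, so
    both pairs are multiples of \<open>(s, t)\<close>.\<close>
  then have nz: "(M24 m, - M14 m) \<noteq> (0, 0) \<or> (- M14 m, M13 m) \<noteq> (0, 0)"
    using m by (auto simp: vec_eq_iff forall_6)
  have "{x, y} \<subseteq> det_plane P (M24 m) (- M14 m)" "{x, y} \<subseteq> det_plane P (- M14 m) (M13 m)"
    using m unfolding m_def minors_simps det_plane_def mem_Collect_eq insert_subset
    by (intro conjI empty_subsetI; algebra)+
  then show ?thesis using nz that by blast
qed

lemma det_ruling_subset_grassmannian: "det_ruling P \<subseteq> grassmannian"
proof
  fix l assume "l \<in> det_ruling P"
  then obtain s t where st: "(s, t) \<noteq> (0, 0)" "l = det_line P s t"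
    by (auto simp: det_ruling_def)
  obtain u v where "distinct_pts u v" "det_plane P s t = vec.span {u, v}"
    using det_plane_basis st(1) by blast
  then show "l \<in> grassmannian"
    by (auto simp: st(2) grassmannian_def det_line_def line_through_def)
qed

lemma line_through_mem_det_ruling:
  assumes "distinct_pts x y"
  shows "line_through x y \<in> det_ruling P \<longleftrightarrow> det_aligned P x y"
proof
  assume "line_through x y \<in> det_ruling P"
  then obtain s t where "(s, t) \<noteq> (0, 0)" "line_through x y = det_line P s t"
    by (auto simp: det_ruling_def)
  then show "det_aligned P x y"
    using proj_pt_mem_line_through[OF assms] assms
    by (auto simp: mem_det_line distinct_pts_def intro: det_aligned_if)
next
  assume "det_aligned P x y"
  then obtain s t where "(s, t) \<noteq> (0, 0)" "x \<in> det_plane P s t" "y \<in> det_plane P s t"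
    using det_plane_if_aligned assms by blast
  then show "line_through x y \<in> det_ruling P"
    using det_line_eq assms unfolding det_ruling_def by blast
qed

section \<open>The ruling as a partition of the quadric\<close>

lemma det_plane_mono:
  assumes "(s, t) \<noteq> (0, 0)" "x \<noteq> 0" "x \<in> det_plane P s t" "x \<in> det_plane P s' t'"
  shows "det_plane P s t \<subseteq> det_plane P s' t'"
proof -
  \<comment> \<open>A nonzero row \<open>(a, b)\<close> killed by two columns makes them
    proportional; \<open>P *v x\<close> supplies such a row.\<close>
  have cross: "s * t' = s' * t" if "s * a + t * b = 0" "s' * a + t' * b = 0" "a \<noteq> 0 \<or> b \<noteq> 0" for a b
  proof -
    have "a * (s * t' - s' * t) = 0" "b * (s * t' - s' * t) = 0"
      using that(1,2) by algebra+
    with that(3) show ?thesis by auto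
  qed
  have "P *v x \<noteq> 0" using assms(2) ker by blast
  then have "s * t' = s' * t"
    using assms(3,4) cross by (auto simp: det_plane_def vec_eq_iff forall_4)
  then have "s' * a + t' * b = 0" if "s * a + t * b = 0" for a b
  proof -
    have "s * (s' * a + t' * b) = 0" "t * (s' * a + t' * b) = 0"
      using that \<open>s * t' = s' * t\<close> by algebra+
    with assms(1) show ?thesis by auto
  qed
  then show ?thesis by (auto simp: det_plane_def)
qed

lemma det_plane_unique:
  assumes "(s, t) \<noteq> (0, 0)" "(s', t') \<noteq> (0, 0)" "x \<noteq> 0" "x \<in> det_plane P s t" "x \<in> det_plane P s' t'"
  shows "det_plane P s t = det_plane P s' t'"
  using assms det_plane_mono by blast

lemma det_form_eq_0_iff:
  assumes "x \<noteq> 0"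
  shows "det_form P x = 0 \<longleftrightarrow> (\<exists>s t. (s, t) \<noteq> (0, 0) \<and> x \<in> det_plane P s t)"
proof
  assume *: "det_form P x = 0"
  let ?A = "(P *v x) $ 1" and ?B = "(P *v x) $ 2" and ?C = "(P *v x) $ 3" and ?D = "(P *v x) $ 4"
  have "P *v x \<noteq> 0" using assms ker by blast
  \<comment> \<open>The kernel column is chosen to kill a nonzero row; the vanishing determinant
    makes it kill the other row too.\<close>
  then have "(?B, - ?A) \<noteq> (0, 0) \<or> (?D, - ?C) \<noteq> (0, 0)"
    by (auto simp: vec_eq_iff forall_4)
  moreover have "x \<in> det_plane P ?B (- ?A)" "x \<in> det_plane P ?D (- ?C)"
    using * by (simp_all add: det_plane_def det_form_def algebra_simps)
  ultimately show "\<exists>s t. (s, t) \<noteq> (0, 0) \<and> x \<in> det_plane P s t" by blast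
next
  assume "\<exists>s t. (s, t) \<noteq> (0, 0) \<and> x \<in> det_plane P s t"
  then obtain s t where st: "(s, t) \<noteq> (0, 0)" "x \<in> det_plane P s t" by blast
  obtain k where k: "(P *v x) $ 1 = k * t" "(P *v x) $ 2 = - k * s"
    using st kernel_pair unfolding det_plane_def by blast
  obtain l where l: "(P *v x) $ 3 = l * t" "(P *v x) $ 4 = - l * s"
    using st kernel_pair unfolding det_plane_def by blast
  show "det_form P x = 0"
    by (simp add: det_form_def k l)
qed

lemma mem_det_quadric:
  assumes "x \<noteq> 0"
  shows "proj_pt x \<in> proj_zeros {det_form P} \<longleftrightarrow> det_form P x = 0"
  using assms by (subst mem_proj_zeros) (auto simp: det_form_scale)

lemma partition_on_det_ruling: "partition_on (proj_zeros {det_form P}) (det_ruling P)"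
proof (rule partition_onI)
  show "\<Union> (det_ruling P) = proj_zeros {det_form P}"
    by (auto simp: det_ruling_def det_line_def proj_zeros_def) (use det_form_eq_0_iff in blast)+
next
  fix p q assume pq: "p \<in> det_ruling P" "q \<in> det_ruling P" "p \<noteq> q"
  then obtain s t s' t' where st: "(s, t) \<noteq> (0, 0)" "p = det_line P s t"
      "(s', t') \<noteq> (0, 0)" "q = det_line P s' t'"
    by (auto simp: det_ruling_def)
  show "disjnt p q"
  proof (rule ccontr)
    assume "\<not> disjnt p q"
    then obtain x where "x \<noteq> 0" "proj_pt x \<in> p" "proj_pt x \<in> q"
      unfolding st(2) by (auto simp: disjnt_def det_line_def)
    then have "det_plane P s t = det_plane P s' t'"
      using st by (intro det_plane_unique) (auto simp: mem_det_line)
    then show False using st pq(3) by (simp add: det_line_def)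
  qed
next
  have "l \<noteq> {}" if "l \<in> det_ruling P" for l
    using that det_ruling_subset_grassmannian proj_pt_mem_line_through
    by (fastforce simp: grassmannian_def)
  then show "{} \<notin> det_ruling P" by blast
qed

section \<open>The opposite ruling and all lines on the quadric\<close>

lemma det_quadric_swap_mid: "det_quadric (swap_mid P)"
proof
  fix x assume "swap_mid P *v x = 0"
  then have "P *v x = 0" by (auto simp: vec_eq_iff forall_4 swap_mid_mult)
  then show "x = 0" by (rule ker)
qed

text \<open>For the transposed matrix the conditions read: coordinates 13 and 24 are zero, and 14 is
  minus 23. Combined with the original ones they kill all six coordinates, as two is
  invertible.\<close>

lemma det_ruling_disjoint: "det_ruling P \<inter> det_ruling (swap_mid P) = {}"
proof -
  have False if "distinct_pts x y" "det_aligned P x y" "det_aligned (swap_mid P) x y" for x y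
  proof -
    define m where "m = minors (P *v x) (P *v y)"
    have "M12 m = 0" "M34 m = 0" "M13 m = 0" "M24 m = 0" "M14 m = M23 m" "M14 m = - M23 m"
      using that(2,3) by (auto simp: det_aligned_def minors_simps swap_mid_mult m_def)
    then have "m = 0" by (simp add: vec_eq_iff forall_6)
    then show False
      using minors_nonzero[of "P *v x" "P *v y"] that(1) by (simp add: m_def distinct_pts_image)
  qed
  then show ?thesis
    using det_ruling_subset_grassmannian line_through_mem_det_ruling
      det_quadric.line_through_mem_det_ruling[OF det_quadric_swap_mid]
    by (fastforce simp: grassmannian_def)
qed

text \<open>The three points given by \<open>x\<close>, \<open>y\<close> and \<open>x + y\<close>
  already decide to which family the line belongs.\<close>

lemma det_aligned_if_subset:
  assumes "distinct_pts x y" "line_through x y \<subseteq> proj_zeros {det_form P}"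
  shows "det_aligned P x y \<or> det_aligned (swap_mid P) x y"
proof -
  have "x + y \<noteq> 0"
    using assms(1) by (auto simp: distinct_pts_iff add_eq_0_iff dest: spec[of _ "- 1"])
  moreover have "x + y \<in> vec.span {x, y}"
    by (intro vec.span_add vec.span_base) auto
  ultimately have "proj_pt (x + y) \<in> line_through x y"
    by (auto simp: line_through_def)
  then have 0: "det_form P x = 0" "det_form P y = 0" "det_form P (x + y) = 0"
    using assms \<open>x + y \<noteq> 0\<close> proj_pt_mem_line_through[OF assms(1)]
    by (auto simp: distinct_pts_def simp flip: mem_det_quadric)
  obtain p q p' q' where x: "(P *v x) $ 1 = p * q" "(P *v x) $ 2 = p * q'"
      "(P *v x) $ 3 = p' * q" "(P *v x) $ 4 = p' * q'"
    using 0(1) rank_one_factor unfolding det_form_def by (metis right_minus_eq)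
  obtain u v u' v' where y: "(P *v y) $ 1 = u * v" "(P *v y) $ 2 = u * v'"
      "(P *v y) $ 3 = u' * v" "(P *v y) $ 4 = u' * v'"
    using 0(2) rank_one_factor unfolding det_form_def by (metis right_minus_eq)
  \<comment> \<open>The determinant of a sum of two outer products is the determinant of the column
    factors times that of the row factors. Proportional row factors share a kernel column,
    proportional column factors a kernel row.\<close>
  have "(p * u' - p' * u) * (q * v' - q' * v) = 0"
    using 0(3) by (simp add: det_form_def vec.add x y algebra_simps)
  then consider "p * u' = p' * u" | "q * v' = q' * v" by auto
  then show ?thesis
  proof cases
    case 1
    then have "det_aligned (swap_mid P) x y"
      unfolding det_aligned_def minors_simps swap_mid_mult x y by (intro conjI; algebra)
    then show ?thesis ..
  next
    case 2
    then have "det_aligned P x y"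
      unfolding det_aligned_def minors_simps x y by (intro conjI; algebra)
    then show ?thesis ..
  qed
qed

lemma lines_on_det_quadric:
  "det_ruling P \<union> det_ruling (swap_mid P) = lines_on (proj_zeros {det_form P})"
proof (intro equalityI subsetI)
  interpret swap: det_quadric "swap_mid P" by (rule det_quadric_swap_mid)
  show "l \<in> lines_on (proj_zeros {det_form P})"
    if "l \<in> det_ruling P \<union> det_ruling (swap_mid P)" for l
    using that partition_onD1[OF partition_on_det_ruling] partition_onD1[OF swap.partition_on_det_ruling]
      det_ruling_subset_grassmannian swap.det_ruling_subset_grassmannian
    by (auto simp: lines_on_def det_form_swap_mid)
  fix l assume l: "l \<in> lines_on (proj_zeros {det_form P})"
  then obtain x y where "distinct_pts x y" "l = line_through x y"
    by (auto simp: lines_on_def grassmannian_def)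
  with l show "l \<in> det_ruling P \<union> det_ruling (swap_mid P)"
    using det_aligned_if_subset
    by (auto simp: lines_on_def line_through_mem_det_ruling swap.line_through_mem_det_ruling)
qed

section \<open>Smoothness\<close>

lemma smooth_det_quadric: "smooth_quadric (proj_zeros {det_form P})"
proof -
  define A :: "'a^4^4" where "A = (\<chi> i j. (P$1$i * P$4$j + P$4$i * P$1$j - P$2$i * P$3$j - P$3$i * P$2$j) / 2)"
  have "transpose A = A"
    by (simp add: A_def transpose_def vec_eq_iff algebra_simps)
  moreover have "quadratic_form A = det_form P"
    by (simp add: fun_eq_iff quadratic_form_def det_form_def A_def matrix_vector_mult_def sum_4 field_simps)
  moreover have "x = 0" if "A *v x = 0" for x
  proof -
    \<comment> \<open>This is twice the bilinear form of \<open>A\<close> at \<open>y\<close> and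
      \<open>x\<close>. By \<open>surj\<close>, \<open>P *v y\<close> takes every value, and the
      unit vectors read off the entries of \<open>P *v x\<close>.\<close>
    have polar: "(P *v y)$1 * (P *v x)$4 + (P *v y)$4 * (P *v x)$1
        - (P *v y)$2 * (P *v x)$3 - (P *v y)$3 * (P *v x)$2 = 0" for y
    proof -
      have "(P *v y)$1 * (P *v x)$4 + (P *v y)$4 * (P *v x)$1
        - (P *v y)$2 * (P *v x)$3 - (P *v y)$3 * (P *v x)$2 = 2 * (\<Sum>i\<in>UNIV. y $ i * (A *v x) $ i)"
        by (simp add: A_def matrix_vector_mult_def sum_4 field_simps)
      then show ?thesis by (simp add: that)
    qed
    have "z$1 * (P *v x)$4 + z$4 * (P *v x)$1 - z$2 * (P *v x)$3 - z$3 * (P *v x)$2 = 0" for z :: "'a^4"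
      using polar surj[of z] by metis
    from this[of "vector [1, 0, 0, 0]"] this[of "vector [0, 1, 0, 0]"]
      this[of "vector [0, 0, 1, 0]"] this[of "vector [0, 0, 0, 1]"]
    have "P *v x = 0" by (simp add: vec_eq_iff forall_4 vector_4)
    then show ?thesis by (rule ker)
  qed
  ultimately show ?thesis
    unfolding smooth_quadric_def by metis
qed

lemma is_ruling_det_ruling: "is_ruling (det_ruling P) (proj_zeros {det_form P})"
  unfolding is_ruling_def
  using det_quadric.partition_on_det_ruling[OF det_quadric_swap_mid]
  by (intro conjI exI[of _ "det_ruling (swap_mid P)"] smooth_det_quadric lines_on_det_quadric det_ruling_disjoint
      partition_on_det_ruling) (simp add: det_form_swap_mid)

text \<open>On the quadric the aligned \<open>y\<close> fill the plane of the unique ruling line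
  through \<open>x\<close>; off it, no line of the ruling contains \<open>x\<close>, which leaves
  only multiples of \<open>x\<close>.\<close>

lemma dim_aligned:
  assumes "x \<noteq> 0"
  shows "vec.dim {y. det_aligned P x y} = (if det_form P x = 0 then 2 else 1)"
proof (cases "det_form P x = 0")
  case True
  then obtain s t where st: "(s, t) \<noteq> (0, 0)" "x \<in> det_plane P s t"
    using det_form_eq_0_iff assms by blast
  have "y \<in> det_plane P s t" if al: "det_aligned P x y" for y
  proof (cases "distinct_pts x y")
    case True
    then obtain s' t' where "(s', t') \<noteq> (0, 0)" "x \<in> det_plane P s' t'" "y \<in> det_plane P s' t'"
      by (rule det_plane_if_aligned[OF _ al])
    then show ?thesis using det_plane_unique[OF _ st(1) assms _ st(2)] by simp
  next
    case False
    then show ?thesis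
      using assms st(2) vec.subspace_scale[OF subspace_det_plane] by (auto simp: distinct_pts_iff)
  qed
  then have "{y. det_aligned P x y} = det_plane P s t"
    using det_aligned_if st by blast
  then show ?thesis using True dim_det_plane st(1) by simp
next
  case False
  have "y \<in> vec.span {x}" if "det_aligned P x y" for y
  proof (rule ccontr)
    assume "y \<notin> vec.span {x}"
    then have "distinct_pts x y"
      using assms by (auto simp: distinct_pts_iff vec.span_singleton)
    then show False
      using det_plane_if_aligned[OF _ that] det_form_eq_0_iff[OF assms] False by metis
  qed
  moreover have "det_aligned P x (c *s x)" for c
    by (simp add: det_aligned_def minors_simps vec.scale)
  ultimately have "{y. det_aligned P x y} = vec.span {x}"
    by (auto simp: vec.span_singleton)
  then show ?thesis using False assms by simp
qed

end

section \<open>Components with a given ruling\<close>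

lemma linear_forms_scale: "linear_forms \<alpha> c (k *s m) = k *s linear_forms \<alpha> c m"
  by (cases c) (simp_all add: vec_eq_iff forall_3 algebra_simps)

lemma linear_forms_add: "linear_forms \<alpha> c (m + n) = linear_forms \<alpha> c m + linear_forms \<alpha> c n"
  by (cases c) (simp_all add: vec_eq_iff forall_3 algebra_simps)

lemma coeff_matrix_mult: "coeff_matrix \<alpha> c x *v y = linear_forms \<alpha> c (minors x y)"
proof -
  have "minors x (y + z) = minors x y + minors x z" "minors x (k *s y) = k *s minors x y" for y z k
    by (simp_all add: vec_eq_iff forall_6 minors_simps algebra_simps)
  then have "Vector_Spaces.linear (*s) (*s) (\<lambda>y. linear_forms \<alpha> c (minors x y))"
    by unfold_locales (simp_all add: linear_forms_add linear_forms_scale)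
  then show ?thesis
    unfolding coeff_matrix_def by (rule matrix_works)
qed

lemma plucker_poly_minors: "plucker_poly (minors a b) = 0"
  by (simp add: plucker_poly_def minors_simps algebra_simps)

lemma plucker_mem_component_set:
  assumes "distinct_pts a b"
  shows "plucker (line_through a b) \<in> component_set \<alpha> c \<longleftrightarrow> linear_forms \<alpha> c (minors a b) = 0"
proof -
  have scale: "plucker_poly (k *s m) = k\<^sup>2 * plucker_poly m" for k m
    by (simp add: plucker_poly_def power2_eq_square algebra_simps)
  show ?thesis
    unfolding plucker_line_through[OF assms] component_set_def
    by (subst mem_proj_zeros)
      (auto simp: minors_nonzero[OF assms] plucker_poly_minors scale linear_forms_scale
        vec_eq_iff[of "linear_forms _ _ _"])
qed

text \<open>Reduces a component to polynomial identities for a suitable \<open>P\<close>; the factor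
  \<open>k\<close> lets the prescribed equation differ from the determinant by a constant.\<close>

lemma quadric_and_rulingI:
  fixes P :: "'a::field_char_0^4^4"
  assumes ker: "\<And>x. P *v x = 0 \<Longrightarrow> x = 0"
    and forms: "\<And>x y. linear_forms \<alpha> c (minors x y) = 0 \<longleftrightarrow> det_aligned P x y"
    and q: "\<And>x. q x = k * det_form P x" "k \<noteq> 0"
    and f: "\<And>s t x. f s t x = s * (P *v x) $ 1 + t * (P *v x) $ 2"
    and g: "\<And>s t x. g s t x = s * (P *v x) $ 3 + t * (P *v x) $ 4"
  shows "quadric_and_ruling \<alpha> c q f g"
proof -
  interpret det_quadric P by unfold_locales (rule ker)
  have Q: "proj_zeros {q} = proj_zeros {det_form P}"
    using q by (simp add: proj_zeros_def)
  \<comment> \<open>With four columns, nullity two means rank two, and nullity one means rank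
    three.\<close>
  have "rank (coeff_matrix \<alpha> c x) = 2 \<longleftrightarrow> det_form P x = 0" if "x \<noteq> 0" for x
    using rank_nullity[of "coeff_matrix \<alpha> c x"] dim_aligned[OF that]
    by (simp add: coeff_matrix_mult forms split: if_splits)
  then have 1: "associated_quadric \<alpha> c = proj_zeros {det_form P}"
    by (auto simp: associated_quadric_def proj_zeros_def)
  have 2: "component_lines \<alpha> c = det_ruling P"
    using det_ruling_subset_grassmannian
    by (auto simp: component_lines_def grassmannian_def plucker_mem_component_set forms
        line_through_mem_det_ruling)
  have 3: "proj_zeros {f s t, g s t} = det_line P s t" for s t
    by (simp add: proj_zeros_def det_line_def det_plane_def f g)
  show ?thesis
    unfolding quadric_and_ruling_def 1 2 3 Q
    using is_ruling_det_ruling by (simp add: det_ruling_def)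
qed

lemma axis_mult: "(\<Sum>j\<in>UNIV. axis i 1 $ j * x $ j) = (x $ i :: 'a::comm_ring_1)"
  by (simp add: axis_def if_distrib[of "\<lambda>z. z * _"] cong: if_cong)

text \<open>Serves \<open>C1\<close> to \<open>C6\<close>. The matrix entries are
  \<open>x$i\<close>, \<open>x$j\<close>, \<open>d * h * x$k\<close>, \<open>d * x$l\<close>, with
  determinant \<open>d\<close> times \<open>q\<close>; the factor \<open>d\<close> adjusts the
  scaling of \<open>g\<close>.\<close>

lemma monomial_quadric_and_ruling:
  fixes \<alpha> :: "'a::field_char_0" and i j k l :: 4
  assumes nz: "h \<noteq> 0" "d \<noteq> 0" and univ: "{i, j, k, l} = UNIV"
    and forms: "\<And>x y. linear_forms \<alpha> c (minors x y) = 0 \<longleftrightarrow>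
      x$i * y$j = x$j * y$i \<and> x$k * y$l = x$l * y$k \<and>
      x$i * y$l - x$l * y$i = h * (x$j * y$k - x$k * y$j)"
    and q: "\<And>x. q x = x$i * x$l - h * (x$j * x$k)"
    and f: "\<And>s t x. f s t x = s * x$i + t * x$j"
    and g: "\<And>s t x. g s t x = s * (d * h * x$k) + t * (d * x$l)"
  shows "quadric_and_ruling \<alpha> c q f g"
proof -
  define P :: "'a^4^4" where "P = vector [axis i 1, axis j 1, (d * h) *s axis k 1, d *s axis l 1]"
  have P: "(P *v x) $ 1 = x$i" "(P *v x) $ 2 = x$j" "(P *v x) $ 3 = d * h * x$k" "(P *v x) $ 4 = d * x$l" for x
    by (simp_all add: P_def matrix_vector_mult_def vector_4 axis_mult mult.assoc flip: sum_distrib_left)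
  show ?thesis
  proof (rule quadric_and_rulingI[where P = P and k = "1 / d"])
    fix x assume "P *v x = 0"
    then have "x$i = 0" "x$j = 0" "x$k = 0" "x$l = 0"
      using nz by (auto simp: vec_eq_iff forall_4 P)
    then have "\<forall>m \<in> {i, j, k, l}. x $ m = 0" by simp
    then show "x = 0" by (simp add: univ vec_eq_iff)
  next
    fix x y :: "'a^4"
    have "d * h * x$k * (d * y$l) - d * x$l * (d * h * y$k) = d * d * h * (x$k * y$l - x$l * y$k)"
      "x$i * (d * y$l) - d * x$l * y$i = d * (x$i * y$l - x$l * y$i)"
      "x$j * (d * h * y$k) - d * h * x$k * y$j = d * (h * (x$j * y$k - x$k * y$j))"
      by (simp_all add: algebra_simps)
    then show "linear_forms \<alpha> c (minors x y) = 0 \<longleftrightarrow> det_aligned P x y"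
      using nz unfolding forms det_aligned_def by (simp add: minors_simps P)
  qed (use nz in \<open>simp_all add: q f g det_form_def P field_simps\<close>)
qed

text \<open>Serves \<open>C7\<close> to \<open>C10\<close>. The matrix entries are the linear
  factors of the two differences of squares in \<open>q\<close>, one of them scaled by
  \<open>d\<close>.\<close>

lemma diagonal_quadric_and_ruling:
  fixes \<alpha> :: "'a::field_char_0"
  assumes nz: "b \<noteq> 0" "h \<noteq> 0" "e \<noteq> 0" and a: "a = b * h" and d: "d = h * e"
    and forms: "\<And>m. linear_forms \<alpha> c m = 0 \<longleftrightarrow>
      M12 m = e * M34 m \<and> M13 m + a * b * M24 m = 0 \<and> M14 m + h * M23 m = 0"
    and q: "\<And>x. q x = (x$1^2 - a^2 * x$2^2) - d * (x$3^2 - b^2 * x$4^2)"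
    and f: "\<And>s t x. f s t x = s * (x$1 + a * x$2) + t * (x$3 + b * x$4)"
    and g: "\<And>s t x. g s t x = s * (d * (x$3 - b * x$4)) + t * (x$1 - a * x$2)"
  shows "quadric_and_ruling \<alpha> c q f g"
proof -
  define P :: "'a^4^4" where
    "P = vector [vector [1, a, 0, 0], vector [0, 0, 1, b], vector [0, 0, d, - d * b], vector [1, - a, 0, 0]]"
  have P: "(P *v x) $ 1 = x$1 + a * x$2" "(P *v x) $ 2 = x$3 + b * x$4"
    "(P *v x) $ 3 = d * (x$3 - b * x$4)" "(P *v x) $ 4 = x$1 - a * x$2" for x
    by (simp_all add: P_def matrix_vector_mult_def vector_4 sum_4 algebra_simps)
  have sum_diff_eq_0: "u + v = 0 \<and> u - v = 0 \<longleftrightarrow> u = 0 \<and> v = 0" for u v :: 'a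
    by (auto simp: eq_neg_iff_add_eq_0)
  show ?thesis
  proof (rule quadric_and_rulingI[where P = P and k = 1])
    fix x assume "P *v x = 0"
    then have *: "(P *v x) $ i = 0" for i by simp
    have "x$1 + a * x$2 = 0 \<and> x$1 - a * x$2 = 0" "x$3 + b * x$4 = 0 \<and> x$3 - b * x$4 = 0"
      using *[of 1] *[of 2] *[of 3] *[of 4] nz unfolding P mult_eq_0_iff d by blast+
    then show "x = 0"
      unfolding sum_diff_eq_0 using nz by (simp add: a vec_eq_iff forall_4)
  next
    fix x y :: "'a^4"
    define m where "m = minors x y"
    let ?u = "M13 m + a * b * M24 m" and ?v = "b * (M14 m + h * M23 m)"
    let ?n = "minors (P *v x) (P *v y)"
    \<comment> \<open>By \<open>a = b * h\<close>, the coordinates 12 and 34 contain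
      \<open>M14 m\<close> and \<open>M23 m\<close> only through \<open>?v\<close>;
      \<open>b * d = a * e\<close> turns the difference of 14 and 23 into a multiple of
      \<open>M12 m - e * M34 m\<close>.\<close>
    have "M12 ?n = ?u + ?v" "M34 ?n = - d * (?u - ?v)" "M14 ?n - M23 ?n = - 2 * a * (M12 m - e * M34 m)"
      by (simp_all add: m_def minors_simps P a d algebra_simps)
    then have "det_aligned P x y \<longleftrightarrow> ?u + ?v = 0 \<and> ?u - ?v = 0 \<and> M12 m - e * M34 m = 0"
      using nz unfolding det_aligned_def by (auto simp: a d)
    also have "\<dots> \<longleftrightarrow> linear_forms \<alpha> c m = 0"
      unfolding forms sum_diff_eq_0 conj_assoc[symmetric]
      using nz by auto
    finally show "linear_forms \<alpha> c (minors x y) = 0 \<longleftrightarrow> det_aligned P x y"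
      by (simp add: m_def)
  qed (simp_all add: q f g det_form_def P power2_eq_square algebra_simps)
qed

lemma primitive_4_square:
  assumes "primitive_root_of_unity 4 (z :: 'a::field)"
  shows "z * z = - 1"
proof -
  \<comment> \<open>Primitivity keeps the first factor from vanishing.\<close>
  have "(z * z - 1) * (z * z + 1) = z ^ 4 - 1"
    by (simp add: algebra_simps eval_nat_numeral)
  moreover have "z ^ 4 = 1" "z ^ 2 \<noteq> 1"
    using assms by (auto simp: primitive_root_of_unity_def)
  ultimately show ?thesis
    by (simp add: power2_eq_square eq_neg_iff_add_eq_0)
qed

theorem theorem4p3p3:
  fixes \<iota> :: "'a::{alg_closed_field, field_char_0}"
  assumes "primitive_root_of_unity 4 \<iota>"
  shows "quadric_and_ruling (1::'a) C1
    (\<lambda>x. x$1 * x$3 - x$2 * x$4)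
    (\<lambda>s t x. s * x$1 + t * x$2)
    (\<lambda>s t x. t * x$3 + s * x$4) \<and>
   quadric_and_ruling (1::'a) C2
    (\<lambda>x. x$1 * x$3 + x$2 * x$4)
    (\<lambda>s t x. s * x$1 + t * x$2)
    (\<lambda>s t x. t * x$3 - s * x$4) \<and>
   quadric_and_ruling (1::'a) C3
    (\<lambda>x. x$1 * x$4 + x$2 * x$3)
    (\<lambda>s t x. s * x$1 + t * x$3)
    (\<lambda>s t x. s * x$2 - t * x$4) \<and>
   quadric_and_ruling (1::'a) C4
    (\<lambda>x. x$1 * x$4 - x$2 * x$3)
    (\<lambda>s t x. s * x$1 + t * x$3)
    (\<lambda>s t x. s * x$2 + t * x$4) \<and>
   quadric_and_ruling (1::'a) C5
    (\<lambda>x. x$1 * x$2 + x$3 * x$4)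
    (\<lambda>s t x. s * x$1 + t * x$4)
    (\<lambda>s t x. t * x$2 - s * x$3) \<and>
   quadric_and_ruling (1::'a) C6
    (\<lambda>x. x$1 * x$2 - x$3 * x$4)
    (\<lambda>s t x. s * x$1 + t * x$4)
    (\<lambda>s t x. t * x$2 + s * x$3) \<and>
   quadric_and_ruling (1::'a) C7
    (\<lambda>x. (x$1^2 - x$2^2) + (x$3^2 - x$4^2))
    (\<lambda>s t x. s * (x$1 - x$2) + t * (x$3 + x$4))
    (\<lambda>s t x. t * (x$1 + x$2) - s * (x$3 - x$4)) \<and>
   quadric_and_ruling (1::'a) C8
    (\<lambda>x. (x$1^2 - x$2^2) - (x$3^2 - x$4^2))
    (\<lambda>s t x. s * (x$1 - x$2) + t * (x$3 - x$4))
    (\<lambda>s t x. t * (x$1 + x$2) + s * (x$3 + x$4)) \<and>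
   quadric_and_ruling (1::'a) C9
    (\<lambda>x. (x$1^2 + x$2^2) + (x$3^2 + x$4^2))
    (\<lambda>s t x. s * (x$1 + \<iota> * x$2) + t * (x$3 + \<iota> * x$4))
    (\<lambda>s t x. t * (x$1 - \<iota> * x$2) - s * (x$3 - \<iota> * x$4)) \<and>
   quadric_and_ruling (1::'a) C10
    (\<lambda>x. (x$1^2 + x$2^2) - (x$3^2 + x$4^2))
    (\<lambda>s t x. s * (x$1 + \<iota> * x$2) + t * (x$3 - \<iota> * x$4))
    (\<lambda>s t x. t * (x$1 - \<iota> * x$2) + s * (x$3 + \<iota> * x$4)) \<and>
   quadric_and_ruling \<iota> C1
    (\<lambda>x. x$1 * x$3 - \<iota> * x$2 * x$4)
    (\<lambda>s t x. s * x$1 + t * x$2)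
    (\<lambda>s t x. t * x$3 + \<iota> * s * x$4) \<and>
   quadric_and_ruling \<iota> C2
    (\<lambda>x. x$1 * x$3 + \<iota> * x$2 * x$4)
    (\<lambda>s t x. s * x$1 + t * x$2)
    (\<lambda>s t x. t * x$3 - \<iota> * s * x$4) \<and>
   quadric_and_ruling \<iota> C3
    (\<lambda>x. x$1 * x$4 + \<iota> * x$2 * x$3)
    (\<lambda>s t x. s * x$1 + t * x$3)
    (\<lambda>s t x. s * x$2 + \<iota> * t * x$4) \<and>
   quadric_and_ruling \<iota> C4
    (\<lambda>x. x$1 * x$4 - \<iota> * x$2 * x$3)
    (\<lambda>s t x. s * x$1 + t * x$3)
    (\<lambda>s t x. s * x$2 - \<iota> * t * x$4) \<and>
   quadric_and_ruling \<iota> C5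
    (\<lambda>x. x$1 * x$2 + x$3 * x$4)
    (\<lambda>s t x. s * x$1 + t * x$4)
    (\<lambda>s t x. t * x$2 - s * x$3) \<and>
   quadric_and_ruling \<iota> C6
    (\<lambda>x. x$1 * x$2 - x$3 * x$4)
    (\<lambda>s t x. s * x$1 + t * x$4)
    (\<lambda>s t x. t * x$2 + s * x$3) \<and>
   quadric_and_ruling \<iota> C7
    (\<lambda>x. (x$1^2 + x$2^2) + \<iota> * (x$3^2 - x$4^2))
    (\<lambda>s t x. s * (x$1 + \<iota> * x$2) + t * (x$3 - x$4))
    (\<lambda>s t x. t * (x$1 - \<iota> * x$2) - \<iota> * s * (x$3 + x$4)) \<and>
   quadric_and_ruling \<iota> C8
    (\<lambda>x. (x$1^2 + x$2^2) - \<iota> * (x$3^2 - x$4^2))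
    (\<lambda>s t x. s * (x$1 + \<iota> * x$2) + t * (x$3 + x$4))
    (\<lambda>s t x. t * (x$1 - \<iota> * x$2) + \<iota> * s * (x$3 - x$4)) \<and>
   quadric_and_ruling \<iota> C9
    (\<lambda>x. (x$1^2 - x$2^2) + \<iota> * (x$3^2 + x$4^2))
    (\<lambda>s t x. s * (x$1 + x$2) + t * (x$3 - \<iota> * x$4))
    (\<lambda>s t x. t * (x$1 - x$2) - \<iota> * s * (x$3 + \<iota> * x$4)) \<and>
   quadric_and_ruling \<iota> C10
    (\<lambda>x. (x$1^2 - x$2^2) - \<iota> * (x$3^2 + x$4^2))
    (\<lambda>s t x. s * (x$1 + x$2) + t * (x$3 + \<iota> * x$4))
    (\<lambda>s t x. t * (x$1 - x$2) + \<iota> * s * (x$3 - \<iota> * x$4))"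
proof -
  have sq: "\<iota> * \<iota> = - 1"
    using assms by (rule primitive_4_square)
  then have nz: "\<iota> \<noteq> 0" by auto
  \<comment> \<open>\<open>algebra_simps\<close> nests products to the right, so \<open>sq\<close>
    must also act in front of a further factor.\<close>
  have cancel: "\<iota> * (\<iota> * x) = - x" for x
    using sq by (simp flip: mult.assoc)
  note simps = sq cancel nz UNIV_4 vec_eq_iff forall_3 vector_3 minors_simps power2_eq_square
    algebra_simps eq_neg_iff_add_eq_0 neg_eq_iff_add_eq_0
  \<comment> \<open>The variables \<open>i, j\<close> occur in \<open>f\<close>, and
    \<open>k, l\<close> go with \<open>s\<close> and \<open>t\<close> in \<open>g\<close>. Below,
    \<open>h\<close> is read off from the quadric and \<open>d\<close> is the coefficient of
    \<open>t * x$l\<close> in \<open>g\<close>.\<close>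
  note mono12 = monomial_quadric_and_ruling[where i = 1 and j = 2 and k = 4 and l = 3]
  note mono13 = monomial_quadric_and_ruling[where i = 1 and j = 3 and k = 2 and l = 4]
  note mono14 = monomial_quadric_and_ruling[where i = 1 and j = 4 and k = 3 and l = 2]
  \<comment> \<open>Here \<open>a\<close> and \<open>b\<close> are read off from \<open>f\<close>,
    and \<open>d\<close> from \<open>g\<close>; then \<open>h = a / b\<close>, and
    \<open>e = d / h\<close> is the sign relating \<open>M12\<close> and \<open>M34\<close>.\<close>
  note diag = diagonal_quadric_and_ruling
  \<comment> \<open>Cases 1 to 10 are the components for \<open>S\<close>, cases 11 to 20 those for
    \<open>T\<close>.\<close>
  show ?thesis
  proof (intro conjI, goal_cases)
    case 1 show ?case
      by (rule mono12[where h = "1" and d = "1"]) (auto simp: simps)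
  next
    case 2 show ?case
      by (rule mono12[where h = "- 1" and d = "1"]) (auto simp: simps)
  next
    case 3 show ?case
      by (rule mono13[where h = "- 1" and d = "- 1"]) (auto simp: simps)
  next
    case 4 show ?case
      by (rule mono13[where h = "1" and d = "1"]) (auto simp: simps)
  next
    case 5 show ?case
      by (rule mono14[where h = "- 1" and d = "1"]) (auto simp: simps)
  next
    case 6 show ?case
      by (rule mono14[where h = "1" and d = "1"]) (auto simp: simps)
  next
    case 7 show ?case
      by (rule diag[where a = "- 1" and b = "1" and d = "- 1" and h = "- 1" and e = "1"]) (auto simp: simps)
  next
    case 8 show ?case
      by (rule diag[where a = "- 1" and b = "- 1" and d = "1" and h = "1" and e = "1"]) (auto simp: simps)
  next
    case 9 show ?case
      by (rule diag[where a = "\<iota>" and b = "\<iota>" and d = "- 1" and h = "1" and e = "- 1"]) (auto simp: simps)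
  next
    case 10 show ?case
      by (rule diag[where a = "\<iota>" and b = "- \<iota>" and d = "1" and h = "- 1" and e = "- 1"]) (auto simp: simps)
  next
    case 11 show ?case
      by (rule mono12[where h = "\<iota>" and d = "1"]) (auto simp: simps)
  next
    case 12 show ?case
      by (rule mono12[where h = "- \<iota>" and d = "1"]) (auto simp: simps)
  next
    case 13 show ?case
      by (rule mono13[where h = "- \<iota>" and d = "\<iota>"]) (auto simp: simps)
  next
    case 14 show ?case
      by (rule mono13[where h = "\<iota>" and d = "- \<iota>"]) (auto simp: simps)
  next
    case 15 show ?case
      by (rule mono14[where h = "- 1" and d = "1"]) (auto simp: simps)
  next
    case 16 show ?case
      by (rule mono14[where h = "1" and d = "1"]) (auto simp: simps)
  next
    case 17 show ?case
      by (rule diag[where a = "\<iota>" and b = "- 1" and d = "- \<iota>" and h = "- \<iota>" and e = "1"]) (auto simp: simps)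
  next
    case 18 show ?case
      by (rule diag[where a = "\<iota>" and b = "1" and d = "\<iota>" and h = "\<iota>" and e = "1"]) (auto simp: simps)
  next
    case 19 show ?case
      by (rule diag[where a = "1" and b = "- \<iota>" and d = "- \<iota>" and h = "\<iota>" and e = "- 1"]) (auto simp: simps)
  next
    case 20 show ?case
      by (rule diag[where a = "1" and b = "\<iota>" and d = "\<iota>" and h = "- \<iota>" and e = "- 1"]) (auto simp: simps)
  qed
qed

end
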